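(* Let $(X,d)$ be a geodesic space. Then the following are equivalent: (1) $\operatorname{UBG}(X)=\operatorname{UBG}(S^1)$. (2) $X$ is similar to $S^1$.
   Context: All graphs are finite, simple and undirected. A geodesic from $x$ to $y$ in a metric space $(X,d)$ is a distance-preserving map $\gamma\colon[0,d(x,y)]\to X$ with $\gamma(0)=x$, $\gamma(d(x,y))=y$; $(X,d)$ is a geodesic space if every two points are joined by a geodesic. A graph $G=(V_G,E_G)$ is a unit ball graph on $(X,d)$ if there exist $\delta>0$ and a map $\rho\colon V_G\to X$ such that for distinct $u,v\in V_G$, $\{u,v\}\in E_G$ if and only if $d(\rho(u),\rho(v))\le\delta$. $\operatorname{UBG}(X)$ denotes the collection of all unit ball graphs on $X$. $S^1$ is the unit circle with the great-circle (arc length) metric. Metric spaces $X,Y$ are similar if there exist a bijection $f\colon X\to Y$ and $r>0$ with $d_Y(f(a),f(b))=r\,d_X(a,b)$ for all $a,b\in X$. *)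

theory Defs
  imports "HOL-Analysis.Analysis"
begin

definition is_geodesic ::
    "'a set \<Rightarrow> ('a \<Rightarrow> 'a \<Rightarrow> real) \<Rightarrow> 'a \<Rightarrow> 'a \<Rightarrow> (real \<Rightarrow> 'a) \<Rightarrow> bool" where
  "is_geodesic M d x y \<gamma> \<longleftrightarrow>
     \<gamma> \<in> {0..d x y} \<rightarrow> M \<and>
     (\<forall>s\<in>{0..d x y}. \<forall>t\<in>{0..d x y}. d (\<gamma> s) (\<gamma> t) = \<bar>s - t\<bar>) \<and>
     \<gamma> 0 = x \<and> \<gamma> (d x y) = y"

locale geodesic_space = Metric_space +
  assumes geodesic_exists: "\<lbrakk>x \<in> M; y \<in> M\<rbrakk> \<Longrightarrow> \<exists>\<gamma>. is_geodesic M d x y \<gamma>"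

text \<open>A graph is a pair of a vertex set and a set of two-element sets of vertices.\<close>

type_synonym 'v ugraph = "'v set \<times> 'v set set"

definition simple_graph :: "'v ugraph \<Rightarrow> bool" where
  "simple_graph G \<longleftrightarrow> finite (fst G) \<and> (\<forall>e\<in>snd G. e \<subseteq> fst G \<and> card e = 2)"

definition unit_ball_graph :: "'a set \<Rightarrow> ('a \<Rightarrow> 'a \<Rightarrow> real) \<Rightarrow> 'v ugraph \<Rightarrow> bool" where
  "unit_ball_graph M d G \<longleftrightarrow> simple_graph G \<and>
     (\<exists>\<delta>>0. \<exists>\<rho>\<in>fst G \<rightarrow> M. \<forall>u\<in>fst G. \<forall>v\<in>fst G. u \<noteq> v \<longrightarrow>
        ({u, v} \<in> snd G \<longleftrightarrow> d (\<rho> u) (\<rho> v) \<le> \<delta>))"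

text \<open>
  The vertices are natural numbers, so that the collection of all unit ball graphs is a set.
  Every finite graph is isomorphic to one on natural numbers, and being a unit ball graph is
  invariant under isomorphism (lemma \<open>unit_ball_graph_iso\<close> below), so equality of these sets
  is equality of the collections of all unit ball graphs.
\<close>

definition UBG :: "'a set \<Rightarrow> ('a \<Rightarrow> 'a \<Rightarrow> real) \<Rightarrow> nat ugraph set" where
  "UBG M d = {G. unit_ball_graph M d G}"

lemma unit_ball_graph_image:
  assumes f: "inj_on f (fst G)" and G: "unit_ball_graph M d G"
  shows "unit_ball_graph M d (f ` fst G, (`) f ` snd G)"
proof -
  obtain V E where VE: "G = (V, E)" by (cases G)
  from G VE obtain \<delta> \<rho> where fin: "finite V" and E: "\<And>e. e \<in> E \<Longrightarrow> e \<subseteq> V \<and> card e = 2"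
    and \<delta>: "\<delta> > 0" and \<rho>: "\<rho> \<in> V \<rightarrow> M"
    and edge: "\<And>u v. \<lbrakk>u \<in> V; v \<in> V; u \<noteq> v\<rbrakk> \<Longrightarrow> {u, v} \<in> E \<longleftrightarrow> d (\<rho> u) (\<rho> v) \<le> \<delta>"
    unfolding unit_ball_graph_def simple_graph_def by auto
  have inj: "inj_on f V" using f VE by simp
  have mem: "{f u, f v} \<in> (`) f ` E \<longleftrightarrow> {u, v} \<in> E" if "u \<in> V" "v \<in> V" for u v
  proof -
    have "{f u, f v} = f ` {u, v}" by simp
    moreover have "f ` {u, v} = f ` e \<longleftrightarrow> {u, v} = e" if "e \<in> E" for e
      using inj_on_image_eq_iff[OF inj, of "{u, v}" e] E[OF that] \<open>u \<in> V\<close> \<open>v \<in> V\<close> by auto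
    ultimately show ?thesis by (auto simp: image_iff)
  qed
  have "simple_graph (f ` V, (`) f ` E)"
    unfolding simple_graph_def using fin E inj
    by (auto simp: card_image[OF inj_on_subset[OF inj]])
  moreover have "(\<rho> \<circ> inv_into V f) \<in> f ` V \<rightarrow> M"
    using \<rho> inj by (auto simp: inv_into_f_f)
  moreover have "\<forall>u\<in>f ` V. \<forall>v\<in>f ` V. u \<noteq> v \<longrightarrow> ({u, v} \<in> (`) f ` E \<longleftrightarrow>
      d ((\<rho> \<circ> inv_into V f) u) ((\<rho> \<circ> inv_into V f) v) \<le> \<delta>)"
  proof clarify
    fix u v assume uv: "u \<in> V" "v \<in> V" "f u \<noteq> f v"
    then have "u \<noteq> v" by auto
    then show "{f u, f v} \<in> (`) f ` E \<longleftrightarrow>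
        d ((\<rho> \<circ> inv_into V f) (f u)) ((\<rho> \<circ> inv_into V f) (f v)) \<le> \<delta>"
      using mem[OF uv(1,2)] edge[OF uv(1,2)] uv inj by (simp add: inv_into_f_f)
  qed
  ultimately show ?thesis
    unfolding unit_ball_graph_def VE fst_conv snd_conv using \<delta> by blast
qed

lemma unit_ball_graph_iso:
  assumes f: "inj_on f (fst G)" and G: "simple_graph G"
  shows "unit_ball_graph M d (f ` fst G, (`) f ` snd G) \<longleftrightarrow> unit_ball_graph M d G"
proof
  let ?g = "inv_into (fst G) f"
  assume H: "unit_ball_graph M d (f ` fst G, (`) f ` snd G)"
  have "?g ` f ` fst G = fst G" using f by simp
  moreover have "(`) ?g ` (`) f ` snd G = snd G"
  proof -
    have "?g ` f ` e = e" if "e \<in> snd G" for e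
      using inv_into_image_cancel[OF f] G that by (auto simp: simple_graph_def)
    then show ?thesis by (simp add: image_image)
  qed
  moreover have "inj_on ?g (f ` fst G)" by (simp add: inj_on_inv_into)
  ultimately show "unit_ball_graph M d G"
    using unit_ball_graph_image[of ?g "(f ` fst G, (`) f ` snd G)" M d, OF _ H] by simp
qed (rule unit_ball_graph_image[OF f])

definition similar_spaces ::
    "'a set \<Rightarrow> ('a \<Rightarrow> 'a \<Rightarrow> real) \<Rightarrow> 'b set \<Rightarrow> ('b \<Rightarrow> 'b \<Rightarrow> real) \<Rightarrow> bool" where
  "similar_spaces M d M' d' \<longleftrightarrow>
     (\<exists>f r. bij_betw f M M' \<and> r > 0 \<and> (\<forall>a\<in>M. \<forall>b\<in>M. d' (f a) (f b) = r * d a b))"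

abbreviation unit_circle :: "complex set" where
  "unit_circle \<equiv> sphere 0 1"

text \<open>
  For unit vectors this is the angle between them, which is the length of the shorter of the
  two arcs joining them.
\<close>

definition arc_dist :: "complex \<Rightarrow> complex \<Rightarrow> real" where
  "arc_dist z w = arccos (z \<bullet> w)"

end

theory Submission
  imports Defs
begin

text \<open>
  Two families of graphs suffice. The claw is not a unit ball graph of the circle, and in a
  claw-free geodesic space at most two geodesics can leave a point in different directions, so
  geodesics do not branch. The 5-cycle is a unit ball graph of the circle, and a 5-cycle in a
  metric space forces a triple of points for which all three triangle inequalities are strict.
  The sides of such a triangle meet only at the vertices and fill the whole space. A geodesic from
  a vertex to its antipode on the opposite side must pass through another vertex, which exhibits
  the space as two geodesics with common ends and no other common points. Again by connectedness,
  a geodesic between points on different halves runs through one of the two ends, which determines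
  the metric.
\<close>

subsection \<open>Segments in metric spaces\<close>

context Metric_space
begin

text \<open>\<open>S\<close> is the image of a geodesic from \<open>x\<close> to \<open>y\<close>.\<close>

definition seg :: "'a \<Rightarrow> 'a \<Rightarrow> 'a set \<Rightarrow> bool" where
  "seg x y S \<longleftrightarrow> x \<in> M \<and> S \<subseteq> M \<and> y \<in> S \<and> d x ` S = {0..d x y} \<and>
     (\<forall>p\<in>S. \<forall>q\<in>S. d p q = \<bar>d x p - d x q\<bar>)"

lemma seg_subset: "seg x y S \<Longrightarrow> S \<subseteq> M"
  and seg_dist: "seg x y S \<Longrightarrow> p \<in> S \<Longrightarrow> q \<in> S \<Longrightarrow> d p q = \<bar>d x p - d x q\<bar>"
  and seg_end: "seg x y S \<Longrightarrow> y \<in> S"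
  and seg_image: "seg x y S \<Longrightarrow> d x ` S = {0..d x y}"
  and seg_in_space: "seg x y S \<Longrightarrow> x \<in> M" "seg x y S \<Longrightarrow> y \<in> M"
  by (auto simp: seg_def)

lemma seg_le: "seg x y S \<Longrightarrow> p \<in> S \<Longrightarrow> d x p \<le> d x y"
  unfolding seg_def by (metis atLeastAtMost_iff image_eqI)

lemma seg_point:
  assumes "seg x y S" "0 \<le> t" "t \<le> d x y"
  obtains p where "p \<in> S" "d x p = t"
proof -
  have "t \<in> d x ` S" using assms by (simp add: seg_def)
  then show ?thesis using that by auto
qed

lemma seg_start: "seg x y S \<Longrightarrow> x \<in> S"
  by (metis nonneg order_refl seg_point seg_def subset_iff zero)

lemma seg_split: "seg x y S \<Longrightarrow> p \<in> S \<Longrightarrow> d x p + d p y = d x y"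
  using seg_dist[of x y S p y] seg_end[of x y S] seg_le[of x y S p] by simp

lemma seg_eqI: "seg x y S \<Longrightarrow> p \<in> S \<Longrightarrow> q \<in> S \<Longrightarrow> d x p = d x q \<Longrightarrow> p = q"
  using seg_dist[of x y S p q] seg_subset[of x y S] zero[of p q] by auto

lemma seg_sym:
  assumes S: "seg x y S"
  shows "seg y x S"
proof -
  have e: "d y p = d x y - d x p" if "p \<in> S" for p
    using seg_split[OF S that] commute[of p y] by simp
  have "d y ` S = (\<lambda>t. d x y - t) ` d x ` S"
    unfolding image_image using e by (intro image_cong) auto
  also have "\<dots> = {0..d x y}"
    using seg_image[OF S] by simp
  finally have "d y ` S = {0..d y x}" by (simp add: commute)
  moreover have "d p q = \<bar>d y p - d y q\<bar>" if "p \<in> S" "q \<in> S" for p q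
    using seg_dist[OF S that] e[OF that(1)] e[OF that(2)] by linarith
  ultimately show ?thesis
    unfolding seg_def using seg_start[OF S] seg_subset[OF S] seg_in_space[OF S] by blast
qed

lemma seg_initial:
  assumes S: "seg x y S" and p: "p \<in> S"
  shows "seg x p {q\<in>S. d x q \<le> d x p}"
proof -
  have "d x ` {q\<in>S. d x q \<le> d x p} = {0..d x p}"
  proof
    show "{0..d x p} \<subseteq> d x ` {q\<in>S. d x q \<le> d x p}"
    proof
      fix t assume t: "t \<in> {0..d x p}"
      then obtain q where "q \<in> S" "d x q = t"
        using seg_point[OF S, of t] seg_le[OF S p] by auto
      then show "t \<in> d x ` {q\<in>S. d x q \<le> d x p}" using t by auto
    qed
  qed auto
  then show ?thesis using S p by (auto simp: seg_def)
qed

lemma seg_final: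
  assumes S: "seg x y S" and p: "p \<in> S"
  shows "seg p y {q\<in>S. d x p \<le> d x q}"
proof -
  have e: "d y q = d x y - d x q" if "q \<in> S" for q
    using seg_split[OF S that] commute[of q y] by simp
  have "{q\<in>S. d y q \<le> d y p} = {q\<in>S. d x p \<le> d x q}"
    using e p by auto
  then show ?thesis
    using seg_sym[OF seg_initial[OF seg_sym[OF S] p]] by simp
qed

text \<open>The triangle inequality through a point \<open>q\<close> of \<open>T\<close> turns
  additivity at \<open>z\<close> into \<open>d x q = d x y + d y q\<close>. Hence \<open>T\<close>
  occupies the parameters from \<open>d x y\<close> to \<open>d x z\<close>.\<close>

lemma seg_concat:
  assumes S: "seg x y S" and T: "seg y z T" and xz: "d x z = d x y + d y z"
  shows "seg x z (S \<union> T)"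
proof -
  have x: "x \<in> M" and y: "y \<in> M" and z: "z \<in> M"
    using seg_in_space S T by auto
  have T_dist: "d x q = d x y + d y q" if "q \<in> T" for q
  proof -
    have q: "q \<in> M" using that seg_subset[OF T] by auto
    show ?thesis
      using triangle[OF x q z] triangle[OF x y q] seg_split[OF T that] xz by linarith
  qed
  have "d x ` T = (+) (d x y) ` d y ` T"
    unfolding image_image by (intro image_cong refl T_dist)
  also have "\<dots> = {d x y..d x z}"
    using seg_image[OF T] xz by simp
  finally have image: "d x ` (S \<union> T) = {0..d x z}"
    using seg_image[OF S] xz ivl_disj_un_two_touch(4)[of 0 "d x y" "d x z"] by (simp add: image_Un)
  have cross: "d p q = \<bar>d x p - d x q\<bar>" if "p \<in> S" "q \<in> T" for p q
  proof -
    have pq: "p \<in> M" "q \<in> M" using that seg_subset S T by auto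
    show ?thesis
      using triangle[OF x pq] triangle[OF pq(1) y pq(2)] seg_split[OF S that(1)] T_dist[OF that(2)]
        nonneg[of y q] nonneg[of p y] by linarith
  qed
  moreover have "d p q = \<bar>d x p - d x q\<bar>" if "p \<in> T" "q \<in> T" for p q
    using seg_dist[OF T that] T_dist[OF that(1)] T_dist[OF that(2)] by linarith
  moreover have "d p q = \<bar>d x p - d x q\<bar>" if "p \<in> T" "q \<in> S" for p q
    using cross[OF that(2,1)] commute[of p q] by simp
  ultimately have "\<forall>p\<in>S \<union> T. \<forall>q\<in>S \<union> T. d p q = \<bar>d x p - d x q\<bar>"
    using seg_dist[OF S] by blast
  with image show ?thesis
    unfolding seg_def using x seg_subset[OF S] seg_subset[OF T] seg_end[OF T] by blast
qed

lemma seg_param: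
  assumes S: "seg x y S"
  obtains \<gamma> where "\<forall>t\<in>{0..d x y}. \<gamma> t \<in> S" "\<forall>t\<in>{0..d x y}. d x (\<gamma> t) = t"
    "\<forall>s\<in>{0..d x y}. \<forall>t\<in>{0..d x y}. d (\<gamma> s) (\<gamma> t) = \<bar>s - t\<bar>"
proof -
  have "\<forall>t\<in>{0..d x y}. \<exists>p. p \<in> S \<and> d x p = t"
    using seg_point[OF S] by (metis atLeastAtMost_iff)
  then obtain \<gamma> where g: "\<forall>t\<in>{0..d x y}. \<gamma> t \<in> S \<and> d x (\<gamma> t) = t" by metis
  moreover have "d (\<gamma> s) (\<gamma> t) = \<bar>s - t\<bar>" if "s \<in> {0..d x y}" "t \<in> {0..d x y}" for s t
    using seg_dist[OF S, of "\<gamma> s" "\<gamma> t"] g that by simp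
  ultimately show ?thesis using that by blast
qed

section \<open>Nearest points and connectedness of segments\<close>

text \<open>Stands in for closedness: it passes to unions of two sets, and a point at distance zero
  from such a set belongs to it.\<close>

definition proximinal :: "'a set \<Rightarrow> bool" where
  "proximinal K \<longleftrightarrow> K \<subseteq> M \<and> (\<forall>z\<in>M. \<exists>p\<in>K. \<forall>q\<in>K. d z p \<le> d z q)"

lemma proximinal_Un:
  assumes "proximinal K" "proximinal L"
  shows "proximinal (K \<union> L)"
  unfolding proximinal_def
proof (intro conjI ballI)
  show "K \<union> L \<subseteq> M" using assms by (auto simp: proximinal_def)
  fix z assume z: "z \<in> M"
  obtain p where p: "p \<in> K" "\<And>r. r \<in> K \<Longrightarrow> d z p \<le> d z r"
    using assms z unfolding proximinal_def by blast
  obtain q where q: "q \<in> L" "\<And>r. r \<in> L \<Longrightarrow> d z q \<le> d z r"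
    using assms z unfolding proximinal_def by blast
  show "\<exists>p\<in>K \<union> L. \<forall>q\<in>K \<union> L. d z p \<le> d z q"
  proof (cases "d z p \<le> d z q")
    case True
    then have "d z p \<le> d z r" if "r \<in> K \<union> L" for r
      using p(2)[of r] q(2)[of r] that by auto
    then show ?thesis using p(1) by blast
  next
    case False
    then have "d z q \<le> d z r" if "r \<in> K \<union> L" for r
      using p(2)[of r] q(2)[of r] that by auto
    then show ?thesis using q(1) by blast
  qed
qed

lemma dist_lipschitz:
  assumes "x \<in> M" "y \<in> M" "z \<in> M" "w \<in> M"
  shows "\<bar>d x y - d z w\<bar> \<le> d x z + d y w"
  using triangle[of x z y] triangle[of z w y] triangle[of z x w] triangle[of x y w] assms
    commute[of x z] commute[of y w] by linarith

text \<open>Along the parametrization, the distance to \<open>z\<close> is a 1-Lipschitz function on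
  a compact interval, so it attains its minimum.\<close>

lemma seg_proximinal:
  assumes S: "seg x y S"
  shows "proximinal S"
  unfolding proximinal_def
proof (intro conjI ballI)
  show SM: "S \<subseteq> M" using S by (rule seg_subset)
  fix z assume z: "z \<in> M"
  obtain \<gamma> where \<gamma>[rule_format]: "\<forall>t\<in>{0..d x y}. \<gamma> t \<in> S" "\<forall>t\<in>{0..d x y}. d x (\<gamma> t) = t"
    "\<forall>s\<in>{0..d x y}. \<forall>t\<in>{0..d x y}. d (\<gamma> s) (\<gamma> t) = \<bar>s - t\<bar>"
    by (rule seg_param[OF S])
  have "1-lipschitz_on {0..d x y} (\<lambda>t. d z (\<gamma> t))"
  proof (rule lipschitz_onI)
    fix s t assume st: "s \<in> {0..d x y}" "t \<in> {0..d x y}"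
    have "\<bar>d z (\<gamma> s) - d z (\<gamma> t)\<bar> \<le> d z z + d (\<gamma> s) (\<gamma> t)"
      using dist_lipschitz z \<gamma>(1) st SM by blast
    then show "dist (d z (\<gamma> s)) (d z (\<gamma> t)) \<le> 1 * dist s t"
      using \<gamma>(3)[OF st] z by (simp add: dist_real_def)
  qed simp
  then have "continuous_on {0..d x y} (\<lambda>t. d z (\<gamma> t))"
    by (rule lipschitz_on_continuous_on)
  then obtain t where t: "t \<in> {0..d x y}" "\<forall>s\<in>{0..d x y}. d z (\<gamma> t) \<le> d z (\<gamma> s)"
    using continuous_attains_inf[of "{0..d x y}" "\<lambda>t. d z (\<gamma> t)"] by auto
  have "d z (\<gamma> t) \<le> d z q" if "q \<in> S" for q
  proof -
    have q: "d x q \<in> {0..d x y}" using seg_le[OF S that] by simp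
    then have "\<gamma> (d x q) = q" using seg_eqI[OF S] \<gamma> that by blast
    then show ?thesis using t q by metis
  qed
  then show "\<exists>p\<in>S. \<forall>q\<in>S. d z p \<le> d z q" using \<gamma>(1) t(1) by blast
qed

text \<open>Connectedness of a segment, in the form of the intermediate value theorem for the
  difference of the distances to \<open>A\<close> and \<open>B\<close>.\<close>

lemma seg_crosses:
  assumes A: "proximinal A" and B: "proximinal B" and M: "M \<subseteq> A \<union> B"
    and S: "seg p q S" and "p \<in> A" "q \<in> B"
  shows "\<exists>w\<in>S. w \<in> A \<inter> B"
proof -
  obtain \<gamma> where \<gamma>[rule_format]: "\<forall>t\<in>{0..d p q}. \<gamma> t \<in> S" "\<forall>t\<in>{0..d p q}. d p (\<gamma> t) = t"
    "\<forall>s\<in>{0..d p q}. \<forall>t\<in>{0..d p q}. d (\<gamma> s) (\<gamma> t) = \<bar>s - t\<bar>"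
    by (rule seg_param[OF S])
  have SM: "S \<subseteq> M" using S by (rule seg_subset)
  \<comment> \<open>The distance from \<open>z\<close> to \<open>K\<close>. For proximinal
    \<open>K\<close> it is attained, 1-Lipschitz, and zero exactly on \<open>K\<close>.\<close>
  define gap where "gap K z = (INF r\<in>K. d z r)" for K z
  have gap: "\<exists>r\<in>K. gap K z = d z r \<and> (\<forall>s\<in>K. d z r \<le> d z s)"
    if K: "proximinal K" "z \<in> M" for K z
  proof -
    obtain r where r: "r \<in> K" "\<forall>s\<in>K. d z r \<le> d z s"
      using K unfolding proximinal_def by blast
    have "gap K z = d z r"
      unfolding gap_def by (rule cInf_eq_minimum) (use r in auto)
    then show ?thesis using r by blast
  qed
  have zero_gap: "gap K z = 0 \<longleftrightarrow> z \<in> K" if "proximinal K" "z \<in> M" for K z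
    using gap[OF that] that zero nonneg unfolding proximinal_def by (metis order_antisym subsetD)
  have gap_le: "gap K z \<le> gap K w + d z w" if K: "proximinal K" and zw: "z \<in> M" "w \<in> M" for K z w
  proof -
    obtain r where r: "r \<in> K" "gap K w = d w r" using gap[OF K zw(2)] by blast
    then have "gap K z \<le> d z r" using gap[OF K zw(1)] by force
    moreover have "r \<in> M" using r K unfolding proximinal_def by blast
    ultimately show ?thesis
      using triangle[OF zw \<open>r \<in> M\<close>] r by simp
  qed
  have cont: "continuous_on {0..d p q} (\<lambda>t. gap K (\<gamma> t))" if K: "proximinal K" for K
  proof (rule lipschitz_on_continuous_on[of 1], rule lipschitz_onI)
    fix s t assume st: "s \<in> {0..d p q}" "t \<in> {0..d p q}"
    then have M: "\<gamma> s \<in> M" "\<gamma> t \<in> M" using \<gamma>(1) SM by auto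
    show "dist (gap K (\<gamma> s)) (gap K (\<gamma> t)) \<le> 1 * dist s t"
      using gap_le[OF K M] gap_le[OF K M(2,1)] commute[of "\<gamma> s" "\<gamma> t"]
      unfolding dist_real_def mult_1 \<gamma>(3)[OF st, symmetric] by linarith
  qed simp
  have gap_ge: "gap K z \<ge> 0" if "proximinal K" "z \<in> M" for K z
    using gap[OF that] by auto
  have pq: "p \<in> M" "q \<in> M" using seg_in_space[OF S] by auto
  have ends: "\<gamma> 0 = p" "\<gamma> (d p q) = q"
    using \<gamma>(1,2)[of 0] \<gamma>(1,2)[of "d p q"] pq
      seg_eqI[OF S _ seg_start[OF S], of "\<gamma> 0"] seg_eqI[OF S _ seg_end[OF S], of "\<gamma> (d p q)"]
    by auto
  txt \<open>As \<open>M\<close> is covered by \<open>A\<close> and \<open>B\<close>, one gap always vanishes, so where they agree both do.\<close>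
  have "\<exists>t\<ge>0. t \<le> d p q \<and> gap A (\<gamma> t) - gap B (\<gamma> t) = 0"
  proof (rule IVT')
    show "gap A (\<gamma> 0) - gap B (\<gamma> 0) \<le> 0"
      using zero_gap[OF A pq(1)] gap_ge[OF B pq(1)] \<open>p \<in> A\<close> ends by simp
    show "0 \<le> gap A (\<gamma> (d p q)) - gap B (\<gamma> (d p q))"
      using zero_gap[OF B pq(2)] gap_ge[OF A pq(2)] \<open>q \<in> B\<close> ends by simp
    show "continuous_on {0..d p q} (\<lambda>t. gap A (\<gamma> t) - gap B (\<gamma> t))"
      by (intro continuous_on_diff cont A B)
  qed simp
  then obtain t where t: "t \<in> {0..d p q}" "gap A (\<gamma> t) = gap B (\<gamma> t)" by auto
  have "\<gamma> t \<in> M" using \<gamma>(1) t SM by auto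
  then have "\<gamma> t \<in> A \<inter> B"
    using zero_gap[OF A, of "\<gamma> t"] zero_gap[OF B, of "\<gamma> t"] t(2) M by auto
  then show ?thesis using \<gamma>(1) t by blast
qed

section \<open>Five-cycles and non-degenerate triples\<close>

text \<open>If all triples were degenerate, each diagonal would be the sum of two consecutive sides,
  and at each vertex one of the two diagonals would be half the perimeter. So at least three
  diagonals are; two of these use disjoint pairs of sides, so the remaining side has length zero. A
  diagonal over that side then has the length of a single side, at most \<open>\<delta>\<close>, a
  contradiction.\<close>

lemma exists_noncollinear_of_5_cycle:
  assumes M: "a \<in> M" "b \<in> M" "c \<in> M" "e \<in> M" "f \<in> M"
    and adj: "d a b \<le> \<delta>" "d b c \<le> \<delta>" "d c e \<le> \<delta>" "d e f \<le> \<delta>" "d f a \<le> \<delta>"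
    and nonadj: "d a c > \<delta>" "d b e > \<delta>" "d c f > \<delta>" "d e a > \<delta>" "d f b > \<delta>"
  shows "\<exists>x\<in>M. \<exists>y\<in>M. \<exists>z\<in>M. d x z < d x y + d y z \<and> d x y < d x z + d z y \<and> d y z < d y x + d x z"
proof (rule ccontr)
  assume "\<not> ?thesis"
  then have col: "d x z \<ge> d x y + d y z \<or> d x y \<ge> d x z + d y z \<or> d y z \<ge> d x y + d x z"
    if "x \<in> M" "y \<in> M" "z \<in> M" for x y z
    using that commute by (metis not_le)
  have path: "d u w = d u v + d v w"
    if "u \<in> M" "v \<in> M" "w \<in> M" "d u v \<le> \<delta>" "d v w \<le> \<delta>" "d u w > \<delta>" for u v w
    using col[OF that(1-3)] triangle[OF that(1-3)] that(4-6) nonneg[of u v] nonneg[of v w]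
    by linarith
  \<comment> \<open>The edge from \<open>v\<close> to \<open>w\<close> is shorter than the two other
    sides, so one of those must be the sum.\<close>
  have ext: "d u v = d u w + d v w \<or> d u w = d u v + d v w"
    if "u \<in> M" "v \<in> M" "w \<in> M" "d v w \<le> \<delta>" "d u v > \<delta>" "d u w > \<delta>" for u v w
    using col[OF that(1,3,2)] triangle[OF that(1,3,2)] triangle[OF that(1,2,3)] that(4-6)
      nonneg[of u v] nonneg[of u w] commute[of v w] by linarith
  have nonadj': "d c a > \<delta>" "d e b > \<delta>" "d f c > \<delta>" "d a e > \<delta>" "d b f > \<delta>"
    using nonadj commute by metis+
  have two: "d a c = d a b + d b c" "d b e = d b c + d c e" "d c f = d c e + d e f"
      "d e a = d e f + d f a" "d f b = d f a + d a b"
    using path M adj nonadj by blast+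
  have "d a c = d e a + d c e \<or> d e a = d a c + d c e"
      "d b e = d f b + d e f \<or> d f b = d b e + d e f"
      "d c f = d a c + d f a \<or> d a c = d c f + d f a"
      "d e a = d b e + d a b \<or> d b e = d e a + d a b"
      "d f b = d c f + d b c \<or> d c f = d f b + d b c"
    using ext[OF M(1,3,4) adj(3) nonadj(1) nonadj'(4)] ext[OF M(2,4,5) adj(4) nonadj(2) nonadj'(5)]
      ext[OF M(3,5,1) adj(5) nonadj(3) nonadj'(1)] ext[OF M(4,1,2) adj(1) nonadj(4) nonadj'(2)]
      ext[OF M(5,2,3) adj(2) nonadj(5) nonadj'(3)]
      commute[of a e] commute[of b f] commute[of c a] commute[of e b] commute[of f c] by auto
  then show False
    using adj nonadj unfolding two by linarith
qed

end

subsection \<open>Claw-free geodesic spaces\<close>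

text \<open>No induced claw at any scale \<open>\<delta>\<close>, with \<open>c\<close> as the
  centre and \<open>p\<close>, \<open>q\<close>, \<open>r\<close> as the leaves. Coinciding leaves
  satisfy the conclusion trivially.\<close>

locale claw_free_geodesic_space = geodesic_space +
  assumes claw_free: "\<lbrakk>c \<in> M; p \<in> M; q \<in> M; r \<in> M; 0 < \<delta>; d c p \<le> \<delta>; d c q \<le> \<delta>; d c r \<le> \<delta>\<rbrakk>
    \<Longrightarrow> d p q \<le> \<delta> \<or> d q r \<le> \<delta> \<or> d p r \<le> \<delta>"
begin

lemma seg_exists:
  assumes "x \<in> M" "y \<in> M"
  obtains S where "seg x y S"
proof -
  obtain \<gamma> where "is_geodesic M d x y \<gamma>" using geodesic_exists assms by blast
  then have \<gamma>: "\<And>t. t \<in> {0..d x y} \<Longrightarrow> \<gamma> t \<in> M" "\<gamma> 0 = x" "\<gamma> (d x y) = y"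
    "\<And>s t. s \<in> {0..d x y} \<Longrightarrow> t \<in> {0..d x y} \<Longrightarrow> d (\<gamma> s) (\<gamma> t) = \<bar>s - t\<bar>"
    unfolding is_geodesic_def by blast+
  have e: "d x (\<gamma> t) = t" if "t \<in> {0..d x y}" for t
    using \<gamma>(4)[of 0 t] \<gamma>(2) that by simp
  have "d p q = \<bar>d x p - d x q\<bar>" if "p \<in> \<gamma> ` {0..d x y}" "q \<in> \<gamma> ` {0..d x y}" for p q
    using that \<gamma>(4) e by (metis imageE)
  moreover have "d x ` \<gamma> ` {0..d x y} = {0..d x y}"
    unfolding image_image using e by simp
  moreover have "y \<in> \<gamma> ` {0..d x y}"
    by (rule image_eqI[of _ _ "d x y"]) (simp_all add: \<gamma>(3))
  moreover have "\<gamma> ` {0..d x y} \<subseteq> M" using \<gamma>(1) by blast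
  ultimately have "seg x y (\<gamma> ` {0..d x y})"
    unfolding seg_def using assms by blast
  then show ?thesis by (rule that)
qed

text \<open>
  If \<open>m\<close> were interior, a claw centred slightly off \<open>m\<close> on a geodesic to \<open>z\<close> would arise: the
  centre at distance \<open>e\<close> from \<open>m\<close>, one leaf at distance \<open>4 * e\<close> beyond it, and the other two on \<open>S\<close>
  at distance \<open>2 * e\<close> from \<open>m\<close> on either side, with threshold \<open>3 * e\<close>. Centring the claw at \<open>m\<close>
  itself would give only non-strict inequalities.
\<close>

lemma nearest_is_endpoint:
  assumes S: "seg x y S" and z: "z \<in> M" "z \<notin> S" and m: "m \<in> S" "\<And>p. p \<in> S \<Longrightarrow> d z m \<le> d z p"
  shows "m = x \<or> m = y"
proof (rule ccontr)
  assume neg: "\<not> (m = x \<or> m = y)"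
  have SM: "S \<subseteq> M" using S by (rule seg_subset)
  have mM: "m \<in> M" and xM: "x \<in> M" and yM: "y \<in> M" using S m seg_in_space seg_subset by blast+
  have pos: "0 < d x m" "0 < d m y" "0 < d m z"
    using neg mM xM yM z m by (auto simp: order_less_le)
  define e where "e = Min {d m z / 4, d x m / 2, d m y / 2}"
  have e: "0 < e" "4 * e \<le> d m z" "2 * e \<le> d x m" "2 * e \<le> d m y"
    using pos by (auto simp: e_def)
  obtain W where W: "seg m z W" using seg_exists mM z by blast
  have WM: "W \<subseteq> M" using W by (rule seg_subset)
  obtain c where c: "c \<in> W" "d m c = e" using seg_point[OF W, of e] e by auto
  obtain r where r: "r \<in> W" "d m r = 4 * e" using seg_point[OF W, of "4 * e"] e by auto
  obtain p where p: "p \<in> S" "d x p = d x m - 2 * e"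
    using seg_point[OF S, of "d x m - 2 * e"] e seg_le[OF S m(1)] by auto
  obtain q where q: "q \<in> S" "d x q = d x m + 2 * e"
    using seg_point[OF S, of "d x m + 2 * e"] e seg_split[OF S m(1)] by auto
  have M: "c \<in> M" "r \<in> M" "p \<in> M" "q \<in> M" using c r p q SM WM by auto
  \<comment> \<open>\<open>r\<close> is closer to \<open>z\<close> than \<open>m\<close> by
    \<open>4 * e\<close>, while no point of \<open>S\<close> is closer to \<open>z\<close> than
    \<open>m\<close>.\<close>
  have far: "4 * e \<le> d u r" if "u \<in> S" for u
  proof -
    have "d z u \<le> d z r + d r u" using triangle z M that SM by blast
    then show ?thesis
      using m(2)[OF that] seg_split[OF W r(1)] r(2) commute[of z m] commute[of z r] commute[of u r]
      by linarith
  qed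
  have "d c p \<le> 3 * e" "d c q \<le> 3 * e" "d c r \<le> 3 * e"
    using triangle[OF M(1) mM M(3)] triangle[OF M(1) mM M(4)] commute[of c m] c(2)
      seg_dist[OF S m(1) p(1)] seg_dist[OF S m(1) q(1)] p q seg_dist[OF W c(1) r(1)] r e
    by auto
  moreover have "d p q > 3 * e" using seg_dist[OF S p(1) q(1)] p q e by simp
  ultimately show False
    using claw_free[OF M(1,3,4,2), of "3 * e"] far[OF p(1)] far[OF q(1)] e by linarith
qed

text \<open>The minimal distance from \<open>z\<close> to \<open>S\<close> is attained, and only at
  ends; an interior point is therefore strictly farther than the nearer end.\<close>

lemma interior_gt_min:
  assumes S: "seg x y S" and z: "z \<in> M" "z \<notin> S" and p: "p \<in> S" "p \<noteq> x" "p \<noteq> y"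
  shows "min (d z x) (d z y) < d z p"
proof (rule ccontr)
  assume le: "\<not> ?thesis"
  obtain m where m: "m \<in> S" "\<forall>q\<in>S. d z m \<le> d z q"
    using seg_proximinal[OF S] z unfolding proximinal_def by blast
  then have "m = x \<or> m = y" using nearest_is_endpoint[OF S z] by blast
  then have "d z p \<le> d z q" if "q \<in> S" for q using m(2) that le by force
  then show False using nearest_is_endpoint[OF S z p(1)] p by blast
qed

text \<open>Seen from \<open>q\<close>, the end \<open>x\<close> of \<open>S\<close> is at distance
  \<open>s\<close> and the end \<open>y\<close> at distance at least \<open>d x y - s\<close>, hence
  at least \<open>s\<close>; the interior point \<open>p\<close> is strictly farther than the nearer
  of them.\<close>

lemma separated_segs:
  assumes S: "seg x y S" and T: "seg x z T" and ST: "S \<inter> T = {x}"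
    and p: "p \<in> S" and q: "q \<in> T" and s: "d x p = s" "d x q = s" "0 < s" "2 * s \<le> d x y"
  shows "s < d p q"
proof -
  have x: "x \<in> M" and y: "y \<in> M" and qM: "q \<in> M" using S T q seg_in_space seg_subset by blast+
  have "q \<notin> S" using ST q s x by force
  moreover have "p \<noteq> x" "p \<noteq> y" using s x by auto
  ultimately have "min (d q x) (d q y) < d q p" using interior_gt_min[OF S qM] p by blast
  then show ?thesis
    using triangle[OF x qM y] s commute[of q x] commute[of q p] by auto
qed

text \<open>Points at a small distance \<open>s\<close> along the three legs have mutual distances
  above \<open>s\<close>, a claw centred at \<open>x\<close>.\<close>

lemma no_tripod:
  assumes S: "seg x y1 S" "seg x y2 T" "seg x y3 U" and y: "y1 \<noteq> x" "y2 \<noteq> x" "y3 \<noteq> x"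
    and disj: "S \<inter> T = {x}" "T \<inter> U = {x}" "S \<inter> U = {x}"
  shows False
proof -
  have M: "x \<in> M" "y1 \<in> M" "y2 \<in> M" "y3 \<in> M" using S seg_in_space seg_subset by blast+
  \<comment> \<open>Halving gives \<open>2 * s\<close> at most the length of each leg, as separation
    of the legs requires.\<close>
  define s where "s = Min {d x y1, d x y2, d x y3} / 2"
  have pos: "0 < d x y1" "0 < d x y2" "0 < d x y3"
    using y M by (auto simp: order_less_le)
  then have s: "0 < s" "2 * s \<le> d x y1" "2 * s \<le> d x y2" "2 * s \<le> d x y3"
    by (auto simp: s_def)
  obtain p where p: "p \<in> S" "d x p = s" using seg_point[OF S(1), of s] s by auto
  obtain q where q: "q \<in> T" "d x q = s" using seg_point[OF S(2), of s] s by auto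
  obtain r where r: "r \<in> U" "d x r = s" using seg_point[OF S(3), of s] s by auto
  have "s < d p q" "s < d q r" "s < d p r"
    using separated_segs[OF S(1,2) disj(1)] separated_segs[OF S(2,3) disj(2)]
      separated_segs[OF S(1,3) disj(3)] p q r s by auto
  then show False
    using claw_free[of x p q r s] p q r s M S[THEN seg_subset] by auto
qed

section \<open>Non-branching of geodesics\<close>

text \<open>If \<open>y\<close> were off \<open>T\<close>, the segments would have a last common
  point, other than \<open>x\<close> because of \<open>p\<close>, and they would branch there into a
  tripod.\<close>

lemma no_branching:
  assumes S: "seg x y S" and T: "seg x z T" and p: "p \<in> S" "p \<in> T" "p \<noteq> x"
    and le: "d x y \<le> d x z"
  shows "y \<in> T"
proof (rule ccontr)
  assume yT: "y \<notin> T"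
  have SM: "S \<subseteq> M" and TM: "T \<subseteq> M" using S T seg_subset by auto
  have x: "x \<in> M" using S by (blast dest: seg_in_space)
  obtain \<gamma> where \<gamma>[rule_format]: "\<forall>t\<in>{0..d x y}. \<gamma> t \<in> S" "\<forall>t\<in>{0..d x y}. d x (\<gamma> t) = t"
    "\<forall>s\<in>{0..d x y}. \<forall>t\<in>{0..d x y}. d (\<gamma> s) (\<gamma> t) = \<bar>s - t\<bar>"
    by (rule seg_param[OF S])
  obtain \<eta> where \<eta>[rule_format]: "\<forall>t\<in>{0..d x z}. \<eta> t \<in> T" "\<forall>t\<in>{0..d x z}. d x (\<eta> t) = t"
    "\<forall>s\<in>{0..d x z}. \<forall>t\<in>{0..d x z}. d (\<eta> s) (\<eta> t) = \<bar>s - t\<bar>"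
    by (rule seg_param[OF T])
  \<comment> \<open>Both segments are parametrized by the distance from \<open>x\<close>, so they
    meet only at equal parameters, the zeros of \<open>D\<close>. This zero set is compact and has a
    largest element.\<close>
  define D where "D t = d (\<gamma> t) (\<eta> t)" for t
  have D0: "D (d x q) = 0" if "q \<in> S" "q \<in> T" for q
  proof -
    have "\<gamma> (d x q) = q"
      using seg_eqI[OF S] \<gamma>[of "d x q"] seg_le[OF S that(1)] that(1) by simp
    moreover have "\<eta> (d x q) = q"
      using seg_eqI[OF T] \<eta>[of "d x q"] seg_le[OF T that(2)] that(2) by simp
    ultimately show ?thesis using that SM by (auto simp: D_def)
  qed
  have "continuous_on {0..d x y} D"
  proof (rule lipschitz_on_continuous_on[of 2], rule lipschitz_onI)
    fix s t assume st: "s \<in> {0..d x y}" "t \<in> {0..d x y}"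
    then have st': "s \<in> {0..d x z}" "t \<in> {0..d x z}" using le by auto
    have "\<bar>D s - D t\<bar> \<le> d (\<gamma> s) (\<gamma> t) + d (\<eta> s) (\<eta> t)"
      unfolding D_def using dist_lipschitz \<gamma>(1)[OF st(1)] \<gamma>(1)[OF st(2)] \<eta>(1)[OF st'(1)]
        \<eta>(1)[OF st'(2)] SM TM by blast
    then show "dist (D s) (D t) \<le> 2 * dist s t"
      using \<gamma>(3)[OF st] \<eta>(3)[OF st'] by (simp add: dist_real_def)
  qed simp
  then have "closed {t \<in> {0..d x y}. D t = 0}"
    by (rule continuous_closed_preimage_constant) simp
  then have "compact ({0..d x y} \<inter> {t \<in> {0..d x y}. D t = 0})"
    by (intro compact_Int_closed) auto
  moreover have "d x p \<in> {0..d x y} \<inter> {t \<in> {0..d x y}. D t = 0}"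
    using D0 p seg_le[OF S] by auto
  ultimately obtain t where t: "t \<in> {0..d x y}" "D t = 0"
    and tmax: "\<And>s. s \<in> {0..d x y} \<Longrightarrow> D s = 0 \<Longrightarrow> s \<le> t"
    using compact_attains_sup[of "{0..d x y} \<inter> {t \<in> {0..d x y}. D t = 0}"] by blast
  have tz: "t \<in> {0..d x z}" using t le by auto
  txt \<open>At the last common point, the common past and the two futures form a tripod.\<close>
  define b where "b = \<gamma> t"
  have bS: "b \<in> S" and xb: "d x b = t" unfolding b_def using \<gamma> t by auto
  have "b = \<eta> t"
    using t(2) \<gamma>(1)[OF t(1)] \<eta>(1)[OF tz] SM TM unfolding D_def b_def by (metis subsetD zero)
  then have bT: "b \<in> T" using \<eta>(1)[OF tz] by simp
  have "0 < d x p" using p SM x by (auto simp: order_less_le)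
  then have "0 < t" using tmax[of "d x p"] D0 p seg_le[OF S] by force
  then have bx: "x \<noteq> b" using xb x by auto
  have yb: "y \<noteq> b" using bT yT by auto
  \<comment> \<open>Here \<open>le\<close> enters: if \<open>T\<close> ended at the branch point, so
    would \<open>S\<close>, against \<open>yb\<close>.\<close>
  have zb: "z \<noteq> b"
  proof
    assume "z = b"
    then have "d x b = d x y" using le t xb by auto
    then show False using yb seg_eqI[OF S bS seg_end[OF S]] by simp
  qed
  have "seg b x {q\<in>S. d x q \<le> d x b}" using seg_sym[OF seg_initial[OF S bS]] .
  moreover have "{q\<in>S. d x q \<le> d x b} \<inter> {q\<in>S. d x b \<le> d x q} = {b}"
    using seg_eqI[OF S] bS by force
  moreover have "{q\<in>S. d x b \<le> d x q} \<inter> {q\<in>T. d x b \<le> d x q} = {b}"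
  proof -
    have "q = b" if "q \<in> S" "q \<in> T" "d x b \<le> d x q" for q
    proof -
      have "d x q \<le> t" using tmax[of "d x q"] D0 seg_le[OF S] that by simp
      then show ?thesis using seg_eqI[OF S] bS xb that by force
    qed
    then show ?thesis using bS bT by blast
  qed
  moreover have "{q\<in>S. d x q \<le> d x b} \<inter> {q\<in>T. d x b \<le> d x q} = {b}"
    using seg_eqI[OF S] bS bT by force
  ultimately show False
    using no_tripod[OF _ seg_final[OF S bS] seg_final[OF T bT]] bx yb zb by blast
qed

section \<open>Geodesic triangles\<close>

text \<open>A second common point would, by non-branching, put the far end of the shorter side on
  the longer one, making the triangle degenerate.\<close>

lemma sides_meet_at_vertex:
  assumes S: "seg x y S" and T: "seg x z T"
    and ne: "d x y < d x z + d z y" "d x z < d x y + d y z"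
  shows "S \<inter> T = {x}"
proof -
  have False if p: "p \<in> S" "p \<in> T" "p \<noteq> x" for p
  proof (cases "d x y \<le> d x z")
    case True
    then have "y \<in> T" using no_branching[OF S T] p by blast
    then show False using seg_split[OF T] ne by simp
  next
    case False
    then have "z \<in> S" using no_branching[OF T S] p by simp
    then show False using seg_split[OF S] ne by simp
  qed
  then show ?thesis using seg_start[OF S] seg_start[OF T] by blast
qed

text \<open>\<open>W\<close> leaves the triangle at \<open>q\<close>. With the two sides at a
  vertex, or with the two pieces of \<open>A\<close> at an interior point, it forms a
  tripod.\<close>

lemma no_nearest_on_side:
  assumes A: "seg x y A" and B: "seg x z B" and C: "seg y z C"
    and ne: "x \<noteq> y" "x \<noteq> z" "y \<noteq> z" and AB: "A \<inter> B = {x}" and AC: "A \<inter> C = {y}"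
    and W: "seg q w W" "q \<noteq> w" and q: "q \<in> A" and WT: "W \<inter> (A \<union> B \<union> C) = {q}"
  shows False
proof (cases "q = x \<or> q = y")
  case True
  then show False
  proof
    assume "q = x"
    moreover from this have "A \<inter> W = {x}" "B \<inter> W = {x}"
      using WT seg_start[OF A] seg_start[OF B] by auto
    ultimately show False using no_tripod[OF A B] W AB ne by metis
  next
    assume "q = y"
    moreover from this have "A \<inter> W = {y}" "C \<inter> W = {y}"
      using WT seg_end[OF A] seg_start[OF C] by auto
    ultimately show False using no_tripod[OF seg_sym[OF A] C] W AC ne by metis
  qed
next
  case False
  let ?I = "{p\<in>A. d x p \<le> d x q}" and ?F = "{p\<in>A. d x q \<le> d x p}"
  have "?I \<inter> ?F = {q}" using seg_eqI[OF A] q by force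
  moreover have "?I \<inter> W = {q}" "?F \<inter> W = {q}" using WT q by auto
  ultimately show False
    using no_tripod[OF seg_sym[OF seg_initial[OF A q]] seg_final[OF A q] W(1)] False W(2) by metis
qed

text \<open>A geodesic from a nearest point \<open>q\<close> of the triangle to an outside point
  \<open>w\<close> meets the triangle only at \<open>q\<close>. The preceding lemma, applied with
  the sides relabelled, excludes \<open>q\<close> from each side.\<close>

lemma triangle_eq_space:
  assumes A: "seg x y A" and B: "seg x z B" and C: "seg y z C"
    and ne: "x \<noteq> y" "x \<noteq> z" "y \<noteq> z" and AB: "A \<inter> B = {x}" and AC: "A \<inter> C = {y}"
    and BC: "B \<inter> C = {z}"
  shows "M = A \<union> B \<union> C"
proof (rule ccontr)
  assume "M \<noteq> A \<union> B \<union> C"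
  then obtain w where w: "w \<in> M" "w \<notin> A \<union> B \<union> C"
    using A B C seg_subset by blast
  have "proximinal (A \<union> B \<union> C)"
    using A B C by (intro proximinal_Un seg_proximinal)
  then obtain q where q: "q \<in> A \<union> B \<union> C" "\<And>r. r \<in> A \<union> B \<union> C \<Longrightarrow> d w q \<le> d w r"
    and qM: "q \<in> M"
    using w(1) unfolding proximinal_def by blast
  obtain W where W: "seg q w W" using seg_exists qM w by blast
  have "r = q" if r: "r \<in> W" "r \<in> A \<union> B \<union> C" for r
  proof -
    have "d q r = 0"
      using seg_split[OF W r(1)] q(2)[OF r(2)] commute[of w r] commute[of w q] nonneg[of q r]
      by linarith
    then show ?thesis using qM r W seg_subset[OF W] by auto
  qed
  then have WT: "W \<inter> (A \<union> B \<union> C) = {q}" using q(1) seg_start[OF W] by blast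
  have qw: "q \<noteq> w" using q(1) w(2) by auto
  have "q \<notin> A" using no_nearest_on_side[OF A B C ne AB AC W qw _ WT] by blast
  moreover have "q \<notin> B"
    using no_nearest_on_side[OF B A seg_sym[OF C] _ _ _ _ BC W qw] ne AB WT
    by (metis Int_commute Un_commute)
  moreover have "q \<notin> C"
    using no_nearest_on_side[OF C seg_sym[OF A] seg_sym[OF B] _ _ _ _ _ W qw] ne AC BC WT
    by (metis Int_commute Un_commute Un_assoc)
  ultimately show False using q(1) by blast
qed

section \<open>From a triangle to a bigon\<close>

lemma exists_bigon:
  assumes M: "x \<in> M" "y \<in> M" "z \<in> M"
    and ne: "d x z < d x y + d y z" "d x y < d x z + d z y" "d y z < d y x + d x z"
  obtains m S T where "m \<noteq> x" "seg x m S" "seg x m T" "S \<union> T = M" "S \<inter> T = {x, m}"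
proof -
  obtain A where A: "seg x y A" using seg_exists M by blast
  obtain B where B: "seg x z B" using seg_exists M by blast
  obtain C where C: "seg y z C" using seg_exists M by blast
  note comm = commute[of y x] commute[of z x] commute[of z y]
  have AB: "A \<inter> B = {x}" using sides_meet_at_vertex[OF A B] ne by blast
  have AC: "A \<inter> C = {y}" using sides_meet_at_vertex[OF seg_sym[OF A] C] ne comm by simp
  have BC: "B \<inter> C = {z}"
    using sides_meet_at_vertex[OF seg_sym[OF B] seg_sym[OF C]] ne comm by simp
  have dist: "x \<noteq> y" "x \<noteq> z" "y \<noteq> z" using ne M by auto
  have MT: "M = A \<union> B \<union> C" using triangle_eq_space[OF A B C dist AB AC BC] .
  \<comment> \<open>The antipode of \<open>x\<close> on the opposite side, the solution of
    \<open>d x y + d y m = d x z + d z m\<close>; the triangle inequalities place it on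
    \<open>C\<close>.\<close>
  obtain m where m: "m \<in> C" "d y m = (d x z + d y z - d x y) / 2"
    using seg_point[OF C, of "(d x z + d y z - d x y) / 2"] ne comm by force
  have mM: "m \<in> M" using m seg_subset[OF C] by auto
  txt \<open>Both ways around the triangle from \<open>x\<close> to \<open>m\<close> have length half the perimeter.\<close>
  have zm: "d z m = (d x y + d y z - d x z) / 2"
    using seg_split[OF C m(1)] m(2) commute[of z m] by (simp add: field_simps)
  obtain W where W: "seg x m W" using seg_exists M mM by blast
  \<comment> \<open>A geodesic from \<open>x\<close> to \<open>m\<close> has to enter
    \<open>C\<close> through \<open>y\<close> or \<open>z\<close>, so it is no shorter than the way
    around the triangle.\<close>
  obtain v where "v \<in> W" "v \<in> (A \<union> B) \<inter> C"
    using seg_crosses[OF proximinal_Un[OF seg_proximinal[OF A] seg_proximinal[OF B]]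
        seg_proximinal[OF C] _ W _ m(1)] MT seg_start[OF A] by blast
  moreover from this have "v = y \<or> v = z" using AC BC by auto
  ultimately have xm: "d x m = (d x y + d x z + d y z) / 2"
    using seg_split[OF W, of v] m(2) zm by (auto simp: field_simps)
  have zq: "d z q = d y z - d y q" if "q \<in> C" for q
    using seg_split[OF C that] commute[of z q] by simp
  define S where "S = A \<union> {q\<in>C. d y q \<le> d y m}"
  define T where "T = B \<union> {q\<in>C. d z q \<le> d z m}"
  have "d x m = d x y + d y m" "d x m = d x z + d z m"
    using xm m(2) zm by (simp_all add: field_simps)
  then have "seg x m S" "seg x m T"
    unfolding S_def T_def
    using seg_concat[OF A seg_initial[OF C m(1)]] seg_concat[OF B seg_initial[OF seg_sym[OF C] m(1)]]
    by blast+
  moreover have "S \<union> T = M"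
    unfolding S_def T_def MT using zq m(1) by (auto simp: not_le)
  moreover have "S \<inter> T = {x, m}"
  proof -
    \<comment> \<open>The strict inequalities put \<open>m\<close> strictly between \<open>y\<close>
      and \<open>z\<close>, so neither half reaches the vertex on the other.\<close>
    have "y \<notin> T" using zq[of y] zq[OF m(1)] m(2) ne M AB dist AC seg_start[OF C] seg_end[OF A] comm
      unfolding T_def by auto
    moreover have "z \<notin> S" using zq[of z] zq[OF m(1)] zm ne M AB dist BC seg_end[OF C] seg_end[OF B] comm
      unfolding S_def by auto
    moreover have "q = m" if "q \<in> C" "d y q \<le> d y m" "d z q \<le> d z m" for q
      using zq[OF that(1)] zq[OF m(1)] that seg_eqI[OF C] m(1) by auto
    moreover have "q \<in> A \<inter> C \<Longrightarrow> q = y" "q \<in> B \<inter> C \<Longrightarrow> q = z" "q \<in> A \<inter> B \<Longrightarrow> q = x" for q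
      using AB AC BC by auto
    ultimately have "S \<inter> T \<subseteq> {x, m}"
      unfolding S_def T_def by blast
    moreover have "x \<in> S \<inter> T" "m \<in> S \<inter> T"
      using m(1) seg_start[OF A] seg_start[OF B] unfolding S_def T_def by auto
    ultimately show ?thesis by blast
  qed
  moreover have "m \<noteq> x" using xm ne M nonneg[of y z] nonneg[of x y] nonneg[of x z] comm by auto
  ultimately show ?thesis using that by blast
qed

text \<open>A geodesic from \<open>p\<close> to \<open>q\<close> passes through \<open>x\<close> or
  \<open>m\<close>; the two terms are the lengths of these routes, which add up to
  \<open>2 * d x m\<close>.\<close>

lemma bigon_dist:
  assumes S: "seg x m S" and T: "seg x m T" and M: "S \<union> T = M" and ST: "S \<inter> T = {x, m}"
    and p: "p \<in> S" and q: "q \<in> T"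
  shows "d p q = min (d x p + d x q) (2 * d x m - (d x p + d x q))"
proof -
  have pq: "p \<in> M" "q \<in> M" "x \<in> M" "m \<in> M"
    using p q S T seg_in_space seg_subset by blast+
  obtain W where W: "seg p q W" using seg_exists pq by blast
  obtain v where "v \<in> W" "v \<in> S \<inter> T"
    using seg_crosses[OF seg_proximinal[OF S] seg_proximinal[OF T] _ W p q] M by blast
  then have "d p q = d p x + d x q \<or> d p q = d p m + d m q"
    using seg_split[OF W] ST by force
  then show ?thesis
    using triangle[of p x q] triangle[of p m q] pq seg_split[OF S p] seg_split[OF T q]
      commute[of p x] commute[of m q] by auto
qed

end

subsection \<open>Unit ball graphs and the circle\<close>

text \<open>A similarity carries placements of the vertices both ways, with the threshold multiplied
  or divided by \<open>r\<close>.\<close>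

lemma unit_ball_graph_similar:
  assumes f: "bij_betw f M M'" and r: "0 < r"
    and iso: "\<And>a b. a \<in> M \<Longrightarrow> b \<in> M \<Longrightarrow> d' (f a) (f b) = r * d a b"
  shows "unit_ball_graph M d G \<longleftrightarrow> unit_ball_graph M' d' G"
proof
  assume "unit_ball_graph M d G"
  then obtain \<delta> \<rho> where G: "simple_graph G" "\<delta> > 0" "\<rho> \<in> fst G \<rightarrow> M"
    and edge: "\<forall>u\<in>fst G. \<forall>v\<in>fst G. u \<noteq> v \<longrightarrow> ({u, v} \<in> snd G \<longleftrightarrow> d (\<rho> u) (\<rho> v) \<le> \<delta>)"
    unfolding unit_ball_graph_def by (elim conjE exE bexE) (rule that)
  have "d' (f (\<rho> u)) (f (\<rho> v)) \<le> r * \<delta> \<longleftrightarrow> d (\<rho> u) (\<rho> v) \<le> \<delta>"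
    if "u \<in> fst G" "v \<in> fst G" for u v
    using iso[of "\<rho> u" "\<rho> v"] G(3) r that by (auto simp: Pi_iff)
  then show "unit_ball_graph M' d' G"
    unfolding unit_ball_graph_def using G edge r bij_betwE[OF f]
    by (intro conjI exI[of _ "r * \<delta>"] bexI[of _ "f \<circ> \<rho>"]) auto
next
  assume "unit_ball_graph M' d' G"
  then obtain \<delta> \<rho> where G: "simple_graph G" "\<delta> > 0" "\<rho> \<in> fst G \<rightarrow> M'"
    and edge: "\<forall>u\<in>fst G. \<forall>v\<in>fst G. u \<noteq> v \<longrightarrow> ({u, v} \<in> snd G \<longleftrightarrow> d' (\<rho> u) (\<rho> v) \<le> \<delta>)"
    unfolding unit_ball_graph_def by (elim conjE exE bexE) (rule that)
  define g where "g = inv_into M f"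
  have g: "g y \<in> M" "f (g y) = y" if "y \<in> M'" for y
    using that f unfolding g_def bij_betw_def by (auto simp: inv_into_into f_inv_into_f)
  have "d (g (\<rho> u)) (g (\<rho> v)) \<le> \<delta> / r \<longleftrightarrow> d' (\<rho> u) (\<rho> v) \<le> \<delta>"
    if "u \<in> fst G" "v \<in> fst G" for u v
  proof -
    have "\<rho> u \<in> M'" "\<rho> v \<in> M'" using that G(3) by auto
    then show ?thesis
      using iso[of "g (\<rho> u)" "g (\<rho> v)"] g r by (simp add: pos_le_divide_eq mult.commute)
  qed
  then show "unit_ball_graph M d G"
    unfolding unit_ball_graph_def using G edge r g(1)
    by (intro conjI exI[of _ "\<delta> / r"] bexI[of _ "g \<circ> \<rho>"]) (auto simp: Pi_iff)
qed

text \<open>Lets a finite configuration of points, with its pattern of distances up to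
  \<open>\<delta>\<close>, be copied into the other space. The graph on \<open>{..<n}\<close>
  records the pattern, and \<open>sym\<close> makes it depend only on unordered pairs.\<close>

lemma UBG_subset_transfer:
  fixes f :: "nat \<Rightarrow> 'a"
  assumes sub: "UBG M d \<subseteq> UBG M' d'" and sym: "\<And>a b. d a b = d b a"
    and f: "\<And>i. i < n \<Longrightarrow> f i \<in> M" and \<delta>: "0 < \<delta>"
  obtains g \<epsilon> where "0 < \<epsilon>" "\<forall>i<n. g i \<in> M'"
    "\<forall>i<n. \<forall>j<n. i \<noteq> j \<longrightarrow> (d' (g i) (g j) \<le> \<epsilon> \<longleftrightarrow> d (f i) (f j) \<le> \<delta>)"
proof -
  define E where "E = {e. \<exists>i<n. \<exists>j<n. i \<noteq> j \<and> d (f i) (f j) \<le> \<delta> \<and> e = {i, j}}"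
  have E: "{u, v} \<in> E \<longleftrightarrow> d (f u) (f v) \<le> \<delta>" if "u < n" "v < n" "u \<noteq> v" for u v
  proof -
    have "d (f u) (f v) \<le> \<delta>" if ij: "d (f i) (f j) \<le> \<delta>" "{u, v} = {i, j}" for i j
      using ij sym by (auto simp: doubleton_eq_iff)
    then show ?thesis unfolding E_def using that by blast
  qed
  have "unit_ball_graph M d ({..<n}, E)"
    unfolding unit_ball_graph_def fst_conv snd_conv
  proof (intro conjI exI[of _ \<delta>] bexI[of _ f])
    show "simple_graph ({..<n}, E)"
      unfolding simple_graph_def E_def by auto
  qed (use E f \<delta> in auto)
  then have "unit_ball_graph M' d' ({..<n}, E)"
    using sub unfolding UBG_def by blast
  then obtain \<epsilon> g where "0 < \<epsilon>" "g \<in> {..<n} \<rightarrow> M'"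
    "\<forall>u\<in>{..<n}. \<forall>v\<in>{..<n}. u \<noteq> v \<longrightarrow> ({u, v} \<in> E \<longleftrightarrow> d' (g u) (g v) \<le> \<epsilon>)"
    unfolding unit_ball_graph_def fst_conv snd_conv by blast
  then show ?thesis using E by (intro that[of \<epsilon> g]) auto
qed

section \<open>The arc length metric\<close>

lemma arc_dist_commute: "arc_dist z w = arc_dist w z"
  by (simp add: arc_dist_def inner_commute)

text \<open>\<open>arccos\<close> inverts \<open>cos\<close> only on \<open>{0..pi}\<close>, so a
  larger angle is replaced by its complement in \<open>2 * pi\<close>.\<close>

lemma arc_dist_cis:
  assumes "\<bar>a - b\<bar> \<le> 2 * pi"
  shows "arc_dist (cis a) (cis b) = min \<bar>a - b\<bar> (2 * pi - \<bar>a - b\<bar>)"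
proof -
  have "arc_dist (cis a) (cis b) = arccos (cos \<bar>a - b\<bar>)"
    by (simp add: arc_dist_def inner_complex_def cos_diff)
  also have "\<dots> = min \<bar>a - b\<bar> (2 * pi - \<bar>a - b\<bar>)"
  proof (cases "\<bar>a - b\<bar> \<le> pi")
    case True
    then show ?thesis using arccos_cos[of "\<bar>a - b\<bar>"] by (simp add: min_def)
  next
    case False
    have "cos \<bar>a - b\<bar> = cos (2 * pi - \<bar>a - b\<bar>)" by (metis cos_2pi_minus)
    moreover have "arccos (cos (2 * pi - \<bar>a - b\<bar>)) = 2 * pi - \<bar>a - b\<bar>"
      using False assms by (intro arccos_cos) auto
    ultimately show ?thesis using False by (simp add: min_def)
  qed
  finally show ?thesis .
qed

text \<open>The rescaled parameter of a circle of circumference \<open>c\<close>; it serves with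
  \<open>c = 2 * L\<close> for the bigon and with \<open>c = 5\<close> for the regular
  pentagon.\<close>

lemma arc_dist_cis_mult:
  assumes k: "0 \<le> k" "k * c = 2 * pi" and st: "\<bar>s - t\<bar> \<le> c"
  shows "arc_dist (cis (k * s)) (cis (k * t)) = k * min \<bar>s - t\<bar> (c - \<bar>s - t\<bar>)"
proof -
  have e: "\<bar>k * s - k * t\<bar> = k * \<bar>s - t\<bar>"
    unfolding right_diff_distrib[symmetric] abs_mult using k by simp
  have "k * \<bar>s - t\<bar> \<le> k * c"
    using k st by (intro mult_left_mono) auto
  then have "arc_dist (cis (k * s)) (cis (k * t)) = min (k * \<bar>s - t\<bar>) (k * (c - \<bar>s - t\<bar>))"
    using arc_dist_cis[of "k * s" "k * t"] unfolding e k(2) right_diff_distrib by blast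
  then show ?thesis
    using k(1) by (simp add: min_mult_distrib_left)
qed

lemma arc_coordinate:
  assumes "c \<in> unit_circle" "p \<in> unit_circle"
  obtains \<alpha> where "\<bar>\<alpha>\<bar> \<le> pi" "p = cis (Arg c + \<alpha>)" "arc_dist c p = \<bar>\<alpha>\<bar>"
proof -
  define \<alpha> where "\<alpha> = Arg (p / c)"
  have c: "c = cis (Arg c)" and "p / c = cis \<alpha>"
    using rcis_cmod_Arg[of c] rcis_cmod_Arg[of "p / c"] assms
    by (simp_all add: rcis_def norm_divide \<alpha>_def)
  moreover have "c \<noteq> 0" using assms(1) by auto
  ultimately have p: "p = cis (Arg c + \<alpha>)"
    by (metis cis_mult nonzero_mult_div_cancel_left times_divide_eq_right)
  have \<alpha>: "\<bar>\<alpha>\<bar> \<le> pi"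
    using mpi_less_Arg[of "p / c"] Arg_le_pi[of "p / c"] by (simp add: \<alpha>_def)
  then have "arc_dist (cis (Arg c)) (cis (Arg c + \<alpha>)) = \<bar>\<alpha>\<bar>"
    by (subst arc_dist_cis) (auto simp: min_def)
  then show ?thesis using that[OF \<alpha> p] c p by metis
qed

text \<open>The signed angles of the leaves relative to \<open>c\<close> lie between
  \<open>-\<delta>\<close> and \<open>\<delta>\<close>. Two of the three lie on the same side of
  zero and so differ by at most \<open>\<delta>\<close>.\<close>

lemma circle_claw_free:
  assumes M: "c \<in> unit_circle" "p \<in> unit_circle" "q \<in> unit_circle" "r \<in> unit_circle"
    and adj: "arc_dist c p \<le> \<delta>" "arc_dist c q \<le> \<delta>" "arc_dist c r \<le> \<delta>"
  shows "arc_dist p q \<le> \<delta> \<or> arc_dist q r \<le> \<delta> \<or> arc_dist p r \<le> \<delta>"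
proof -
  obtain \<alpha> where a: "\<bar>\<alpha>\<bar> \<le> pi" "p = cis (Arg c + \<alpha>)" "\<bar>\<alpha>\<bar> \<le> \<delta>"
    using arc_coordinate[OF M(1,2)] adj by metis
  obtain \<beta> where b: "\<bar>\<beta>\<bar> \<le> pi" "q = cis (Arg c + \<beta>)" "\<bar>\<beta>\<bar> \<le> \<delta>"
    using arc_coordinate[OF M(1,3)] adj by metis
  obtain \<gamma> where c: "\<bar>\<gamma>\<bar> \<le> pi" "r = cis (Arg c + \<gamma>)" "\<bar>\<gamma>\<bar> \<le> \<delta>"
    using arc_coordinate[OF M(1,4)] adj by metis
  have dist: "arc_dist (cis (Arg c + s)) (cis (Arg c + t)) \<le> \<bar>s - t\<bar>"
    if "\<bar>s\<bar> \<le> pi" "\<bar>t\<bar> \<le> pi" for s t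
    using arc_dist_cis[of "Arg c + s" "Arg c + t"] that by (simp add: min_def)
  have "\<bar>\<alpha> - \<beta>\<bar> \<le> \<delta> \<or> \<bar>\<beta> - \<gamma>\<bar> \<le> \<delta> \<or> \<bar>\<alpha> - \<gamma>\<bar> \<le> \<delta>"
    using a(3) b(3) c(3) by linarith
  then show ?thesis
    using dist[OF a(1) b(1)] dist[OF b(1) c(1)] dist[OF a(1) c(1)] a(2) b(2) c(2) by fastforce
qed

context claw_free_geodesic_space
begin

text \<open>Signed distance from \<open>x\<close>, positive on \<open>S\<close> and negative on the
  rest of \<open>T\<close>, is a coordinate on a circle of circumference \<open>2 * L\<close>, and
  \<open>cis\<close> wraps it onto the unit circle.\<close>

lemma bigon_similar_circle:
  assumes S: "seg x m S" and T: "seg x m T" and M: "S \<union> T = M" and ST: "S \<inter> T = {x, m}"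
    and "m \<noteq> x"
  shows "similar_spaces M d unit_circle arc_dist"
proof -
  have xm: "x \<in> M" "m \<in> M" using seg_in_space[OF S] by auto
  define L where "L = d x m"
  have L: "0 < L" using xm \<open>m \<noteq> x\<close> by (auto simp: L_def order_less_le)
  \<comment> \<open>The common end \<open>m\<close> counts as a point of \<open>S\<close> and gets
    the value \<open>L\<close>, so the range is half-open like that of \<open>Arg\<close>.\<close>
  define \<sigma> where "\<sigma> p = (if p \<in> S then d x p else - d x p)" for p
  have le: "d x p \<le> L" if "p \<in> M" for p
    using that M seg_le[OF S] seg_le[OF T] by (auto simp: L_def)
  have \<sigma>_le: "\<bar>\<sigma> p\<bar> \<le> L" if "p \<in> M" for p
    using le[OF that] by (simp add: \<sigma>_def)
  \<comment> \<open>The routes through \<open>x\<close> and through \<open>m\<close> have total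
    length at most \<open>2 * L\<close>. On a single half this bound decides which term of the
    minimum is the distance.\<close>
  have half: "d p q \<le> L" if "p \<in> M" "q \<in> M" for p q
    using triangle[OF that(1) xm(1) that(2)] triangle[OF that(1) xm(2) that(2)] that M
      seg_split[OF S] seg_split[OF T] commute[of p x] commute[of m q]
    unfolding L_def by (smt (verit) UnE)
  have dist: "d p q = min \<bar>\<sigma> p - \<sigma> q\<bar> (2 * L - \<bar>\<sigma> p - \<sigma> q\<bar>)" if pq: "p \<in> M" "q \<in> M" for p q
  proof -
    have same: ?thesis if "d p q = \<bar>d x p - d x q\<bar>" "\<bar>\<sigma> p - \<sigma> q\<bar> = \<bar>d x p - d x q\<bar>"
      using that half[OF pq] by simp
    have *: "\<bar>d x p + d x q\<bar> = d x p + d x q" using nonneg[of x p] nonneg[of x q] by linarith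
    consider "p \<in> S" "q \<in> S" | "p \<in> T" "q \<in> T" "p \<notin> S" "q \<notin> S"
      | "p \<in> S" "q \<in> T" "q \<notin> S" | "q \<in> S" "p \<in> T" "p \<notin> S"
      using pq M by blast
    then show ?thesis
    proof cases
      case 1
      then show ?thesis using same seg_dist[OF S] by (simp add: \<sigma>_def)
    next
      case 2
      then show ?thesis using same seg_dist[OF T 2(1,2)] by (simp add: \<sigma>_def abs_minus_commute)
    next
      case 3
      then show ?thesis
        using bigon_dist[OF S T M ST 3(1,2)] * by (simp add: \<sigma>_def L_def)
    next
      case 4
      have "\<bar>- d x p - d x q\<bar> = d x q + d x p" using * by linarith
      then show ?thesis
        using bigon_dist[OF S T M ST 4(1,2)] 4 commute[of p q] by (simp add: \<sigma>_def L_def)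
    qed
  qed
  define f where "f p = cis (pi / L * \<sigma> p)" for p
  have iso: "arc_dist (f p) (f q) = pi / L * d p q" if pq: "p \<in> M" "q \<in> M" for p q
  proof -
    have "\<bar>\<sigma> p - \<sigma> q\<bar> \<le> 2 * L"
      using \<sigma>_le[OF pq(1)] \<sigma>_le[OF pq(2)] by linarith
    then show ?thesis
      unfolding f_def dist[OF pq] using L by (intro arc_dist_cis_mult) auto
  qed
  have "bij_betw f M unit_circle"
    unfolding bij_betw_def
  proof
    show "inj_on f M"
    proof (rule inj_onI)
      fix p q assume pq: "p \<in> M" "q \<in> M" "f p = f q"
      have "arc_dist (f p) (f q) = pi / L * d p p" using iso[of p p] pq by simp
      then show "p = q" using iso[OF pq(1,2)] pq L by simp
    qed
    show "f ` M = unit_circle"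
    proof
      show "f ` M \<subseteq> unit_circle" by (auto simp: f_def)
      show "unit_circle \<subseteq> f ` M"
      proof
        fix z assume z: "z \<in> unit_circle"
        then have zA: "z = cis (Arg z)" using rcis_cmod_Arg[of z] by (simp add: rcis_def)
        have A: "- pi < Arg z" "Arg z \<le> pi" using mpi_less_Arg Arg_le_pi by auto
        define t where "t = L * Arg z / pi"
        have t: "- L < t" "t \<le> L" "pi / L * t = Arg z"
          using A L mult_strict_left_mono[OF A(1) L] by (auto simp: t_def field_simps)
        obtain p where "p \<in> M" "\<sigma> p = t"
        proof (cases "0 \<le> t")
          case True
          then obtain p where "p \<in> S" "d x p = t"
            using seg_point[OF S] t(2) unfolding L_def by metis
          then show ?thesis using that[of p] M by (auto simp: \<sigma>_def)
        next
          case False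
          then obtain p where p: "p \<in> T" "d x p = - t"
            using seg_point[OF T, of "- t"] t(1) unfolding L_def by force
          then have "p \<noteq> x" "p \<noteq> m" using False t(1) xm by (auto simp: L_def)
          \<comment> \<open>The strict bound \<open>- L < t\<close> keeps \<open>p\<close> away from
            \<open>m\<close>, where the sign of the coordinate would be positive.\<close>
          then have "p \<notin> S" using p(1) ST by blast
          then show ?thesis using that[of p] p M by (auto simp: \<sigma>_def)
        qed
        then show "z \<in> f ` M" using zA t(3) unfolding f_def by (metis image_eqI)
      qed
    qed
  qed
  then show ?thesis
    unfolding similar_spaces_def using iso L by (intro exI[of _ f] exI[of _ "pi / L"]) auto
qed

end

theorem corollary1p14:
  fixes X :: "'a set" and d :: "'a \<Rightarrow> 'a \<Rightarrow> real"
  assumes "geodesic_space X d"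
  shows "UBG X d = UBG unit_circle arc_dist \<longleftrightarrow> similar_spaces X d unit_circle arc_dist"
proof
  assume "similar_spaces X d unit_circle arc_dist"
  then obtain f r where "bij_betw f X unit_circle" "r > 0"
    "\<forall>a\<in>X. \<forall>b\<in>X. arc_dist (f a) (f b) = r * d a b"
    unfolding similar_spaces_def by blast
  then have "unit_ball_graph X d G \<longleftrightarrow> unit_ball_graph unit_circle arc_dist G" for G :: "nat ugraph"
    by (intro unit_ball_graph_similar) auto
  then show "UBG X d = UBG unit_circle arc_dist"
    unfolding UBG_def by blast
next
  assume eq: "UBG X d = UBG unit_circle arc_dist"
  interpret geodesic_space X d by (rule assms)
  interpret claw_free_geodesic_space X d
  proof unfold_locales
    fix c p q r \<delta>
    assume M: "c \<in> X" "p \<in> X" "q \<in> X" "r \<in> X" and "0 < \<delta>"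
      and adj: "d c p \<le> \<delta>" "d c q \<le> \<delta>" "d c r \<le> \<delta>"
    \<comment> \<open>Index 0 is the centre of the claw and 1, 2, 3 are its leaves; the
      configuration is copied to the circle.\<close>
    define f where "f = (\<lambda>i. [c, p, q, r] ! i)"
    have fX: "f i \<in> X" if "i < 4" for i
    proof -
      have "f i \<in> set [c, p, q, r]" unfolding f_def using that by (intro nth_mem) simp
      then show ?thesis using M by auto
    qed
    obtain g \<epsilon> where g[rule_format]: "0 < \<epsilon>" "\<forall>i<4. g i \<in> unit_circle"
      "\<forall>i<4. \<forall>j<4. i \<noteq> j \<longrightarrow> (arc_dist (g i) (g j) \<le> \<epsilon> \<longleftrightarrow> d (f i) (f j) \<le> \<delta>)"
      by (rule UBG_subset_transfer[OF equalityD1[OF eq] commute fX \<open>0 < \<delta>\<close>])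
    have f: "f 0 = c" "f 1 = p" "f 2 = q" "f 3 = r" by (simp_all add: f_def numeral_3_eq_3)
    show "d p q \<le> \<delta> \<or> d q r \<le> \<delta> \<or> d p r \<le> \<delta>"
      using circle_claw_free[of "g 0" "g 1" "g 2" "g 3" \<epsilon>] adj
        g(2)[of 0] g(2)[of 1] g(2)[of 2] g(2)[of 3]
        g(3)[of 0 1] g(3)[of 0 2] g(3)[of 0 3] g(3)[of 1 2] g(3)[of 2 3] g(3)[of 1 3]
      unfolding f by simp
  qed
  \<comment> \<open>The regular pentagon: with the length of a side as threshold, sides are edges
    and diagonals are not.\<close>
  define f where "f i = cis (2 * pi / 5 * real i)" for i
  have f_circle: "f i \<in> unit_circle" if "i < 5" for i by (simp add: f_def)
  have "0 < 2 * pi / 5" by simp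
  obtain g \<epsilon> where g[rule_format]: "0 < \<epsilon>" "\<forall>i<5. g i \<in> X"
    "\<forall>i<5. \<forall>j<5. i \<noteq> j \<longrightarrow> (d (g i) (g j) \<le> \<epsilon> \<longleftrightarrow> arc_dist (f i) (f j) \<le> 2 * pi / 5)"
    by (rule UBG_subset_transfer[OF equalityD2[OF eq] arc_dist_commute f_circle \<open>0 < 2 * pi / 5\<close>])
  have arc: "arc_dist (f i) (f j) = 2 * pi / 5 * min \<bar>real i - real j\<bar> (5 - \<bar>real i - real j\<bar>)"
    if "i < 5" "j < 5" for i j
    unfolding f_def using that by (intro arc_dist_cis_mult) auto
  \<comment> \<open>Dividing by \<open>2 * pi / 5\<close> turns adjacency into cyclic distance of
    the indices at most 1.\<close>
  have adj: "d (g i) (g j) \<le> \<epsilon> \<longleftrightarrow> min \<bar>real i - real j\<bar> (5 - \<bar>real i - real j\<bar>) \<le> 1"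
    if "i < 5" "j < 5" "i \<noteq> j" for i j
    using g(3)[OF that] arc[OF that(1,2)] mult_le_cancel_left_pos[of "2 * pi / 5" _ 1] by simp
  have M: "g 0 \<in> X" "g 1 \<in> X" "g 2 \<in> X" "g 3 \<in> X" "g 4 \<in> X"
    using g(2) by auto
  have "\<exists>x\<in>X. \<exists>y\<in>X. \<exists>z\<in>X. d x z < d x y + d y z \<and> d x y < d x z + d z y \<and> d y z < d y x + d x z"
    by (rule exists_noncollinear_of_5_cycle[OF M, of \<epsilon>])
      (use adj[of 0 1] adj[of 1 2] adj[of 2 3] adj[of 3 4] adj[of 4 0]
        adj[of 0 2] adj[of 1 3] adj[of 2 4] adj[of 3 0] adj[of 4 1] in \<open>simp_all add: not_le\<close>)
  then show "similar_spaces X d unit_circle arc_dist"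
    using exists_bigon bigon_similar_circle by metis
qed

end
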